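(* Let $G$ be a directed simple graph on $n$ nodes and let $H$ be a spanning subgraph of $G$ where the in- and outdegree equals one for all nodes in $H$. Let $X \in \{0,1\}^{n\times n}$ be the adjacency matrix of $H$ and let $X^{(2)} := X \cdot X$ be the distance two adjacency matrix. Let $k_n^{(2)} := \cos(2\pi/n) + \cos(4\pi/n)$ and $h_n^{(2)} := 2 - k_n^{(2)}$, and let $\alpha^{(2)}, \beta^{(2)} \in \mathbb{R}$ be such that $\alpha^{(2)} \ge h_n^{(2)}/n$ and $k_n^{(2)} \le \beta^{(2)} < 2$. Then $H$ is a directed Hamiltonian cycle if and only if $$\beta^{(2)} I_n + \alpha^{(2)} J_n - \tfrac12 \big( (X + X^{(2)}) + (X + X^{(2)})^\top \big) \succeq 0.$$
   Context: $I_n$ is the identity matrix and $J_n$ the all-ones matrix of order $n$; $\succeq 0$ denotes positive semidefiniteness. The adjacency matrix of a directed graph has entry $(i,j)$ equal to $1$ if there is an arc from $i$ to $j$ and $0$ otherwise. A directed Hamiltonian cycle is a directed cycle visiting all nodes exactly once.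
   Formalization: For n = 4 it is additionally assumed that β^(2) ≥ 0; as stated, the claim fails for the directed 4-cycle with −1 ≤ β^(2) < 0, where the matrix is not positive semidefinite (test vector (1,−1,1,−1)). *)

theory Defs
  imports "HOL-Analysis.Analysis" "Graph_Theory.Graph_Theory"
begin

text \<open>
  Square matrices of order \<open>n\<close> are indexed by a finite type with \<open>n\<close> elements, and the same
  type serves as the vertex set of the digraphs.
\<close>

definition adjacency_matrix :: "('n::finite, 'b) pre_digraph \<Rightarrow> real^'n^'n" where
  "adjacency_matrix H = (\<chi> i j. if (i, j) \<in> arcs_ends H then 1 else 0)"

definition all_ones :: "real^'n^'n" where
  "all_ones = (\<chi> i j. 1)"

definition positive_semidefinite :: "real^'n^'n \<Rightarrow> bool" where
  "positive_semidefinite A \<longleftrightarrow> transpose A = A \<and> (\<forall>x. 0 \<le> x \<bullet> (A *v x))"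

text \<open>
  The predicate is about the digraph \<open>H\<close> itself: a single directed cycle uses all of its arcs
  and visits all of its vertices. That each vertex is visited only once is part of
  \<^const>\<open>pre_digraph.cycle\<close>. Cycles of length 2 (a pair of opposite arcs) are allowed.
\<close>

definition directed_hamiltonian_cycle :: "('a, 'b) pre_digraph \<Rightarrow> bool" where
  "directed_hamiltonian_cycle H \<longleftrightarrow>
     (\<exists>u p. pre_digraph.cycle H p \<and> pre_digraph.awalk H u p u \<and>
            set p = arcs H \<and> set (pre_digraph.awalk_verts H u p) = verts H)"

definition k2 :: "nat \<Rightarrow> real" where
  "k2 n = cos (2 * pi / real n) + cos (4 * pi / real n)"

definition h2 :: "nat \<Rightarrow> real" where
  "h2 n = 2 - k2 n"

end

theory Submission
  imports Defs
begin

text \<open>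
  Sending each vertex to its out-neighbour is a permutation \<open>s\<close>, and the quadratic form of the
  matrix is \<open>\<beta> \<Sum> x\<^sub>i\<^sup>2 + \<alpha> (\<Sum> x\<^sub>i)\<^sup>2 - \<Sum> x\<^sub>i x\<^bsub>s i\<^esub> - \<Sum> x\<^sub>i x\<^bsub>s (s i)\<^esub>\<close>. If \<open>s\<close> is a single
  cycle, the discrete Fourier transform along it diagonalises the form: at frequency \<open>k \<noteq> 0\<close> the
  eigenvalue is \<open>\<beta> - cos (2 \<pi> k / n) - cos (4 \<pi> k / n)\<close>, where the two cosines sum to at most
  \<open>k2 n\<close> (to at most \<open>0\<close> if \<open>n = 4\<close>, where \<open>k2 4 = -1\<close>), and at frequency \<open>0\<close> it is
  \<open>\<beta> + \<alpha> n - 2\<close>. If \<open>s\<close> has an orbit \<open>C\<close> that is not everything, the \<open>s\<close>-invariant vector equal to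
  \<open>n - |C|\<close> on \<open>C\<close> and \<open>-|C|\<close> off \<open>C\<close> has sum zero, so the form takes there the negative value
  \<open>(\<beta> - 2) \<Sum> x\<^sub>i\<^sup>2\<close>.
\<close>

section \<open>Cosine sums and bounds at the n-th roots of unity\<close>

text \<open>The sum is the real part of a geometric sum over the powers of an n-th root of unity
  \<open>z\<close>, which vanishes unless \<open>z = 1\<close>.\<close>

lemma sum_cos_multiples:
  fixes m :: int
  assumes "n > 0"
  shows "(\<Sum>k<n. cos (2 * pi * real k * of_int m / real n)) = (if int n dvd m then real n else 0)"
proof -
  define z where "z = cis (2 * pi * of_int m / real n)"
  have pow: "z ^ k = cis (2 * pi * real k * of_int m / real n)" for k
    unfolding z_def Complex.DeMoivre by (simp add: mult_ac)
  have *: "(\<Sum>k<n. cos (2 * pi * real k * of_int m / real n)) = Re (\<Sum>k<n. z ^ k)"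
    by (simp add: pow)
  show ?thesis
  proof (cases "int n dvd m")
    case True
    then obtain c where "m = int n * c" ..
    then have "z = cis (2 * pi * of_int c)"
      using assms by (simp add: z_def mult_ac)
    then have "z = 1"
      by (metis cis_multiple_2pi Ints_of_int)
    then show ?thesis
      using True by (simp add: *)
  next
    case False
    have "z \<noteq> 1"
    proof
      assume "z = 1"
      then have "cos (2 * pi * of_int m / real n) = 1"
        unfolding z_def by (metis Re_complex_of_real cis.sel(1) of_real_1)
      then obtain c :: int where "2 * pi * of_int m / real n = of_int c * 2 * pi"
        unfolding cos_one_2pi_int by blast
      then have "real_of_int m = real_of_int (c * int n)"
        using assms by (simp add: field_simps)
      then have "m = c * int n"
        by linarith
      with False show False by simp
    qed
    moreover have "z ^ n = 1"
      using assms cis_multiple_2pi[of "of_int m"] by (simp add: pow mult.assoc)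
    ultimately have "(\<Sum>k<n. z ^ k) = 0"
      by (simp add: geometric_sum)
    then show ?thesis
      using False by (simp add: *)
  qed
qed

text \<open>Cosine decreases on [0, \<pi>], which covers \<open>2 * k \<le> n\<close>; the
  reflection of \<open>k\<close> to \<open>n - k\<close> preserves the cosine and covers the
  rest.\<close>

lemma cos_multiple_le:
  assumes "0 < k" "k < n"
  shows "cos (2 * pi * real k / real n) \<le> cos (2 * pi / real n)"
proof -
  have *: "cos (2 * pi * real j / real n) \<le> cos (2 * pi / real n)" if "0 < j" "2 * j \<le> n" for j
  proof (rule cos_monotone_0_pi_le)
    have "real 2 * real j \<le> real n"
      using that(2) by (metis of_nat_le_iff of_nat_mult)
    then show "2 * pi * real j / real n \<le> pi"
      using assms by (simp add: field_simps)
    show "2 * pi / real n \<le> 2 * pi * real j / real n"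
      using assms that by (intro divide_right_mono) auto
  qed simp
  show ?thesis
  proof (cases "2 * k \<le> n")
    case True
    with * assms show ?thesis by blast
  next
    case False
    have "2 * pi * real k / real n = 2 * pi - 2 * pi * real (n - k) / real n"
      using assms by (simp add: of_nat_diff field_simps)
    then have "cos (2 * pi * real k / real n) = cos (2 * pi * real (n - k) / real n)"
      by (simp add: cos_diff)
    then show ?thesis
      using *[of "n - k"] False assms by simp
  qed
qed

text \<open>By angle doubling, both sides are values of the convex quadratic 2 c^2 + c - 1, with
  \<open>c \<le> d\<close>. The bound can only fail if c lies below -1/2 - d, the mirror image of d
  in the axis of the parabola. For \<open>n \<ge> 6\<close> this image is at most -1. For
  \<open>n = 4\<close> and \<open>k = 2\<close> the bound does fail: c = -1, d = 0.\<close>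

lemma sum_cos_le_k2:
  assumes "0 < k" "k < n" and "n \<noteq> 4"
  shows "cos (2 * pi * real k / real n) + cos (4 * pi * real k / real n) \<le> k2 n"
proof -
  define c where "c = cos (2 * pi * real k / real n)"
  define d where "d = cos (2 * pi / real n)"
  have dbl: "cos (4 * pi * real k / real n) = 2 * c\<^sup>2 - 1"
    using cos_double_cos[of "2 * pi * real k / real n"] by (simp add: c_def mult_ac)
  have dbl': "cos (4 * pi / real n) = 2 * d\<^sup>2 - 1"
    using cos_double_cos[of "2 * pi / real n"] by (simp add: d_def mult_ac)
  have "c \<le> d"
    using cos_multiple_le[OF assms(1,2)] by (simp add: c_def d_def)
  \<comment> \<open>\<open>(c - d) (2 (c + d) + 1)\<close> is the difference of the two sides of the claim.\<close>
  moreover have "c = d \<or> 0 \<le> 2 * (c + d) + 1"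
  proof (cases "n \<ge> 6")
    case True
    have "cos (pi / 3) \<le> d"
      unfolding d_def using True by (intro cos_monotone_0_pi_le) (auto simp: field_simps)
    moreover have "- 1 \<le> c"
      by (simp add: c_def)
    ultimately show ?thesis
      by (simp add: cos_60)
  next
    case False
    have eq: "c = d" if "k = n - 1"
    proof -
      have "2 * pi * real k / real n = 2 * pi - 2 * pi / real n"
        using assms that by (simp add: of_nat_diff field_simps)
      then show ?thesis
        by (simp add: c_def d_def cos_diff)
    qed
    \<comment> \<open>Only n = 2, 3, 5 remain, and k = 1 and k = n - 1 both give c = d.\<close>
    consider "n = 5 \<and> (k = 2 \<or> k = 3)" | "k = 1" | "k = n - 1"
      using False assms by linarith
    then show ?thesis
    proof cases
      case 1
      \<comment> \<open>Doubling the angle interchanges \<open>c\<close> and \<open>d\<close>, so the claim is an equality here.\<close>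
      then have "c = cos (4 * pi / 5)"
      proof (elim conjE disjE)
        assume "n = 5" "k = 3"
        then have "2 * pi * real k / real n = 2 * pi - 4 * pi / 5" by simp
        then show ?thesis unfolding c_def by (simp only: cos_diff) simp
      qed (simp add: c_def)
      then have c: "c = 2 * d\<^sup>2 - 1"
        using 1 dbl' by simp
      have "cos (8 * pi / 5) = 2 * c\<^sup>2 - 1"
        using cos_double_cos[of "4 * pi / 5"] \<open>c = cos (4 * pi / 5)\<close> by simp
      moreover have "cos (8 * pi / 5) = d"
      proof -
        have "cos (8 * pi / 5) = cos (2 * pi - 2 * pi / 5)" by simp
        also have "\<dots> = d"
          using 1 by (simp only: cos_diff) (auto simp: d_def)
        finally show ?thesis .
      qed
      ultimately have "d = 2 * c\<^sup>2 - 1" by simp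
      moreover have "(c - d) * (2 * (c + d) + 1) = (2 * c\<^sup>2 + c) - (2 * d\<^sup>2 + d)"
        by (simp add: algebra_simps power2_eq_square)
      ultimately have "(c - d) * (2 * (c + d) + 1) = 0"
        using c by linarith
      then show ?thesis by auto
    qed (use eq in \<open>auto simp: c_def d_def\<close>)
  qed
  ultimately have "(c - d) * (2 * (c + d) + 1) \<le> 0"
    by (auto simp: mult_nonpos_nonneg)
  then show ?thesis
    unfolding k2_def dbl dbl' c_def[symmetric] d_def[symmetric]
    by (simp add: algebra_simps power2_eq_square)
qed

lemma sum_cos_order4_le_0:
  "0 < k \<Longrightarrow> k < 4 \<Longrightarrow> cos (2 * pi * real k / 4) + cos (4 * pi * real k / 4) \<le> 0"
proof -
  assume "0 < k" "k < 4"
  then consider "k = 1" | "k = 2" | "k = 3" by linarith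
  then show ?thesis
  proof cases
    case 3
    have *: "2 * pi * 3 / 4 = pi + pi / 2" "4 * pi * 3 / 4 = 2 * pi + pi" by simp_all
    show ?thesis
      unfolding 3 of_nat_numeral * by (simp add: cos_add)
  qed auto
qed

section \<open>Fourier analysis of the form along a cycle\<close>

text \<open>A discrete Wiener-Khinchin identity: \<open>P\<close> is the power spectrum of
  \<open>x\<close>, and its cosine transform is the autocorrelation at lag \<open>s\<close>. It
  follows from orthogonality of the cosines once \<open>P\<close> is expanded as a double
  sum.\<close>

lemma dft_power_spectrum_shift:
  fixes x :: "nat \<Rightarrow> real"
  assumes "n > 0" and per: "\<And>j. x (j + n) = x j"
  defines "P \<equiv> \<lambda>k. (\<Sum>j<n. x j * cos (2 * pi * real k * real j / real n))\<^sup>2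
                  + (\<Sum>j<n. x j * sin (2 * pi * real k * real j / real n))\<^sup>2"
  shows "(\<Sum>k<n. P k * cos (2 * pi * real k * real s / real n)) = real n * (\<Sum>j<n. x j * x (j + s))"
proof -
  define t where "t k m = 2 * pi * real k * of_int m / real n" for k and m :: int
  define \<delta> where "\<delta> m = (if int n dvd m then real n else 0)" for m :: int
  have \<delta>_sum: "\<delta> m = (\<Sum>k<n. cos (t k m))" for m
    using sum_cos_multiples[OF assms(1)] by (simp add: \<delta>_def t_def)
  \<comment> \<open>Shifted indices \<open>j + s\<close> can leave the range below \<open>n\<close>;
    periodicity brings them back.\<close>
  have per_mod: "x (j mod n) = x j" for j
  proof -
    have "x (i + q * n) = x i" for i q
    proof (induction q)
      case (Suc q)
      then show ?case
        using per[of "i + q * n"] by (simp add: add_ac)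
    qed simp
    from this[of "j mod n" "j div n"] show ?thesis by simp
  qed
  have P: "P k = (\<Sum>j<n. \<Sum>l<n. x j * x l * cos (t k (int j - int l)))" for k
  proof -
    have t_diff: "t k (int j - int l) = t k (int j) - t k (int l)" for j l
      by (simp add: t_def diff_divide_distrib algebra_simps)
    have "P k = (\<Sum>j<n. x j * cos (t k (int j)))\<^sup>2 + (\<Sum>j<n. x j * sin (t k (int j)))\<^sup>2"
      by (simp add: P_def t_def)
    then show ?thesis
      by (simp add: power2_eq_square sum_product sum.distrib[symmetric] t_diff cos_diff algebra_simps)
  qed
  have prod: "cos (t k m) * cos (t k (int s)) = (cos (t k (m + int s)) + cos (t k (m - int s))) / 2" for k m
  proof -
    have "t k (m + int s) = t k m + t k (int s)" "t k (m - int s) = t k m - t k (int s)"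
      by (simp_all add: t_def add_divide_distrib diff_divide_distrib algebra_simps)
    then show ?thesis by (simp add: cos_times_cos)
  qed
  have pick: "(\<Sum>l<n. x l * \<delta> (int i - int l)) = real n * x i" for i
  proof -
    have "int n dvd int i - int l \<longleftrightarrow> l = i mod n" if "l < n" for l
      using that by (metis mod_eq_dvd_iff mod_less of_nat_eq_iff zmod_int)
    then have "(\<Sum>l<n. x l * \<delta> (int i - int l)) = (\<Sum>l<n. if l = i mod n then x l * real n else 0)"
      by (intro sum.cong) (auto simp: \<delta>_def)
    also have "\<dots> = x (i mod n) * real n"
      using assms(1) by simp
    finally show ?thesis by (simp add: per_mod)
  qed
  \<comment> \<open>Since \<delta> is even, the terms shifted by -s are those shifted by s with
    \<open>j\<close> and \<open>l\<close> exchanged, so the two halves from \<open>prod\<close>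
    agree.\<close>
  have \<delta>_minus: "\<delta> (- m) = \<delta> m" for m
    by (simp add: \<delta>_def)
  have "(\<Sum>k<n. P k * cos (t k (int s)))
      = (\<Sum>k<n. \<Sum>j<n. \<Sum>l<n. x j * x l * ((cos (t k (int j - int l + int s)) + cos (t k (int j - int l - int s))) / 2))"
    by (simp only: P sum_distrib_right prod[symmetric] mult.assoc)
  also have "\<dots> = (\<Sum>j<n. \<Sum>l<n. \<Sum>k<n. x j * x l * ((cos (t k (int j - int l + int s)) + cos (t k (int j - int l - int s))) / 2))"
    by (subst sum.swap, intro sum.cong refl sum.swap)
  also have "\<dots> = (\<Sum>j<n. \<Sum>l<n. x j * x l * ((\<delta> (int j - int l + int s) + \<delta> (int j - int l - int s)) / 2))"
    by (simp only: \<delta>_sum sum_distrib_left[symmetric] sum_divide_distrib[symmetric] sum.distrib)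
  also have "\<dots> = ((\<Sum>j<n. x j * (\<Sum>l<n. x l * \<delta> (int (j + s) - int l)))
                 + (\<Sum>j<n. \<Sum>l<n. x l * (x j * \<delta> (int (l + s) - int j)))) / 2"
  proof -
    have "\<delta> (int j - int l - int s) = \<delta> (int (l + s) - int j)" for j l
      using \<delta>_minus[of "int j - int l - int s"] by (simp add: algebra_simps)
    then show ?thesis
      by (simp add: sum_distrib_left sum_divide_distrib sum.distrib[symmetric] algebra_simps add_divide_distrib)
  qed
  also have "(\<Sum>j<n. \<Sum>l<n. x l * (x j * \<delta> (int (l + s) - int j)))
           = (\<Sum>l<n. x l * (\<Sum>j<n. x j * \<delta> (int (l + s) - int j)))"
    by (subst sum.swap) (simp add: sum_distrib_left)
  also have "(\<Sum>j<n. x j * (\<Sum>l<n. x l * \<delta> (int (j + s) - int l))) = real n * (\<Sum>j<n. x j * x (j + s))"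
    unfolding pick by (simp add: sum_distrib_left mult_ac)
  finally show ?thesis
    by (simp add: t_def)
qed

text \<open>The correlation identity at lags 0, 1 and 2 writes \<open>n\<close> times the form as a
  combination of the \<open>P k\<close>, all of whose coefficients are nonnegative.\<close>

lemma periodic_quadratic_form_nonneg:
  fixes x :: "nat \<Rightarrow> real"
  assumes "n > 0" and per: "\<And>j. x (j + n) = x j"
    and \<alpha>: "h2 n / real n \<le> \<alpha>" and \<beta>: "k2 n \<le> \<beta>" and n4: "n = 4 \<Longrightarrow> 0 \<le> \<beta>"
  shows "0 \<le> \<beta> * (\<Sum>j<n. (x j)\<^sup>2) + \<alpha> * (\<Sum>j<n. x j)\<^sup>2
             - (\<Sum>j<n. x j * x (j + 1)) - (\<Sum>j<n. x j * x (j + 2))"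
proof -
  define P where "P = (\<lambda>k. (\<Sum>j<n. x j * cos (2 * pi * real k * real j / real n))\<^sup>2
                  + (\<Sum>j<n. x j * sin (2 * pi * real k * real j / real n))\<^sup>2)"
  have dft: "(\<Sum>k<n. P k * cos (2 * pi * real k * real s / real n)) = real n * (\<Sum>j<n. x j * x (j + s))" for s
    unfolding P_def by (rule dft_power_spectrum_shift) (use assms(1) per in auto)
  define c where "c k = cos (2 * pi * real k / real n) + cos (4 * pi * real k / real n)" for k
  have "P k \<ge> 0" for k
    by (simp add: P_def)
  have P0: "P 0 = (\<Sum>j<n. x j)\<^sup>2"
    by (simp add: P_def)
  have bound: "c k \<le> \<beta>" if "k \<in> {..<n} - {0}" for k
  proof (cases "n = 4")
    case True
    then show ?thesis
      using sum_cos_order4_le_0[of k] that n4 by (simp add: c_def)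
  next
    case False
    then show ?thesis
      using sum_cos_le_k2[of k n] that \<beta> by (simp add: c_def)
  qed
  have "2 - k2 n \<le> \<alpha> * real n"
    using \<alpha> assms(1) by (simp add: h2_def field_simps)
  \<comment> \<open>Here \<open>c 0 = 2\<close>, so the bounds on \<alpha> and \<beta> add up
    exactly to this. Frequency 0 is treated apart because \<open>\<beta> - c 0\<close> alone may be
    negative.\<close>
  then have zero: "0 \<le> \<beta> - c 0 + \<alpha> * real n"
    using \<beta> by (simp add: c_def)
  have "0 \<le> (\<beta> - c 0 + \<alpha> * real n) * P 0 + (\<Sum>k\<in>{..<n} - {0}. (\<beta> - c k) * P k)"
    using zero bound \<open>\<And>k. P k \<ge> 0\<close>
    by (intro add_nonneg_nonneg[OF mult_nonneg_nonneg sum_nonneg] mult_nonneg_nonneg) auto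
  also have "\<dots> = (\<Sum>k<n. (\<beta> - c k) * P k) + \<alpha> * real n * P 0"
    using assms(1) by (simp add: sum.remove[of "{..<n}" 0] algebra_simps)
  also have "(\<Sum>k<n. (\<beta> - c k) * P k) = \<beta> * (\<Sum>k<n. P k * cos (2 * pi * real k * real 0 / real n))
      - (\<Sum>k<n. P k * cos (2 * pi * real k * real 1 / real n)) - (\<Sum>k<n. P k * cos (2 * pi * real k * real 2 / real n))"
    by (simp add: c_def sum_distrib_left sum_subtractf[symmetric] algebra_simps)
  finally have "0 \<le> real n * (\<beta> * (\<Sum>j<n. (x j)\<^sup>2) + \<alpha> * (\<Sum>j<n. x j)\<^sup>2
             - (\<Sum>j<n. x j * x (j + 1)) - (\<Sum>j<n. x j * x (j + 2)))"
    unfolding dft P0 by (simp add: algebra_simps power2_eq_square)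
  then show ?thesis
    using assms(1) by (simp add: zero_le_mult_iff)
qed


section \<open>Permutation orbits and Hamiltonian cycles\<close>

text \<open>The first positive return time of \<open>u\<close> counts the distinct elements of its
  orbit, so here it is the cardinality of the type.\<close>

lemma orbit_eq_UNIV_enumerates:
  fixes f :: "'a::finite \<Rightarrow> 'a"
  assumes "bij f" and "orbit f u = UNIV"
  shows "bij_betw (\<lambda>j. (f ^^ j) u) {..<CARD('a)} UNIV" and "(f ^^ CARD('a)) u = u"
proof -
  have u: "u \<in> orbit f u" by (simp add: assms)
  define d where "d = funpow_dist1 f u u"
  have inj: "inj_on (\<lambda>j. (f ^^ j) u) {..<d}"
    using inj_on_funpow_dist1[OF u] by (simp add: d_def lessThan_atLeast0)
  have range: "(\<lambda>j. (f ^^ j) u) ` {..<d} = UNIV"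
    using orbit_conv_funpow_dist1[OF u] by (simp add: assms d_def lessThan_atLeast0)
  have "d = CARD('a)"
    using card_image[OF inj] range by simp
  then show "bij_betw (\<lambda>j. (f ^^ j) u) {..<CARD('a)} UNIV" "(f ^^ CARD('a)) u = u"
    using inj range funpow_dist1_prop[OF u] by (simp_all only: d_def bij_betw_def)
qed

text \<open>\<open>e v\<close> is the only arc leaving \<open>v\<close>. Indegree one makes
  \<open>s\<close> injective, hence bijective by finiteness. The map \<open>e\<close> is kept beside
  \<open>s\<close> because cycles are lists of arcs.\<close>

lemma one_regular_digraph_successor:
  fixes H :: "('n::finite, 'b) pre_digraph"
  assumes "wf_digraph H" and "verts H = UNIV"
    and deg: "\<And>v. in_degree H v = 1 \<and> out_degree H v = 1"
  obtains s e where "bij s" "arcs H = range e" "\<And>v. tail H (e v) = v" "\<And>v. head H (e v) = s v"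
proof -
  have "\<exists>a. out_arcs H v = {a}" for v
    using deg[of v] by (simp add: out_degree_def card_1_singleton_iff)
  then obtain e where e: "\<And>v. out_arcs H v = {e v}" by metis
  have "\<exists>a. in_arcs H v = {a}" for v
    using deg[of v] by (simp add: in_degree_def card_1_singleton_iff)
  then obtain i where i: "\<And>v. in_arcs H v = {i v}" by metis
  have arcs_e: "e v \<in> arcs H" and tail_e: "tail H (e v) = v" for v
    using e[of v] in_out_arcs_conv[of "e v" H v] by simp_all
  have arcs: "arcs H = range e"
  proof
    show "arcs H \<subseteq> range e"
      using e in_out_arcs_conv by fastforce
  qed (use arcs_e in auto)
  define s where "s v = head H (e v)" for v
  have "inj s"
  proof (rule injI)
    fix v w assume "s v = s w"
    then have "e v \<in> in_arcs H (s v)" "e w \<in> in_arcs H (s v)"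
      using arcs_e by (simp_all add: s_def)
    then have "e v = e w"
      by (simp add: i)
    then show "v = w"
      using tail_e by metis
  qed
  then have "bij s"
    by (simp add: bij_def finite_UNIV_inj_surj)
  from this arcs tail_e show thesis
    by (rule that) (simp add: s_def)
qed

text \<open>Every arc leads from some \<open>v\<close> to \<open>s v\<close>, so walks from
  \<open>u\<close> stay in the orbit of \<open>u\<close>; conversely, a full orbit is traversed by
  the arcs \<open>e ((s ^^ j) u)\<close>.\<close>

lemma hamiltonian_cycle_iff_orbit:
  fixes H :: "('n::finite, 'b) pre_digraph"
  assumes "wf_digraph H" and V: "verts H = UNIV"
    and "bij s" and arcs: "arcs H = range e"
    and tail: "\<And>v. tail H (e v) = v" and head: "\<And>v. head H (e v) = s v"
  shows "directed_hamiltonian_cycle H \<longleftrightarrow> (\<exists>u. orbit s u = UNIV)"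
proof
  interpret wf_digraph H by fact
  have self: "u \<in> orbit s u" for u
    using \<open>bij s\<close> by (intro permutation_self_in_orbit) (simp add: permutation)
  assume "directed_hamiltonian_cycle H"
  then obtain u p where p: "awalk u p u" "set (awalk_verts u p) = UNIV"
    unfolding directed_hamiltonian_cycle_def V by blast
  have "v \<in> orbit s u" for v
  proof -
    have "u \<rightarrow>\<^sup>*\<^bsub>H\<^esub> v"
      using awalk_verts_reachable_from[OF p(1)] p(2) by simp
    then have "(u, v) \<in> (arcs_ends H)\<^sup>*"
      by (rule reachable_rtranclI)
    then show ?thesis
    proof (induction rule: rtrancl_induct)
      case base
      show ?case by (rule self)
    next
      case (step v w)
      from step(2) have "w = s v"
        by (auto simp: arcs_ends_conv arcs tail head)
      with step(3) show ?case
        by (simp add: orbit.step)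
    qed
  qed
  then show "\<exists>u. orbit s u = UNIV" by blast
next
  interpret wf_digraph H by fact
  define n where "n = CARD('n)"
  assume "\<exists>u. orbit s u = UNIV"
  then obtain u where "orbit s u = UNIV" ..
  note enum = orbit_eq_UNIV_enumerates[OF \<open>bij s\<close> this, folded n_def]
  have inj: "inj_on (\<lambda>j. (s ^^ j) u) {..<n}" and range: "(\<lambda>j. (s ^^ j) u) ` {..<n} = UNIV"
    using enum(1) by (auto simp: bij_betw_def)
  have "n > 0" by (simp add: n_def)
  define p where "p = map (\<lambda>j. e ((s ^^ j) u)) [0..<n]"
  have set_p: "set p = arcs H"
    using range by (simp add: p_def arcs image_image[of e "\<lambda>j. (s ^^ j) u", symmetric] lessThan_atLeast0)
  have "p \<noteq> []"
    using \<open>n > 0\<close> by (simp add: p_def)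
  \<comment> \<open>The start vertex \<open>v\<close> matters only for the empty walk; otherwise the
    vertices are read off the arcs, one more than there are arcs.\<close>
  have verts: "awalk_verts v (map (\<lambda>j. e ((s ^^ j) u)) [0..<m]) = (if m = 0 then [v] else map (\<lambda>j. (s ^^ j) u) [0..<Suc m])" for v m
    by (cases m) (auto simp: awalk_verts_conv tail head)
  have "cas u (map (\<lambda>j. e ((s ^^ j) u)) [0..<m]) ((s ^^ m) u)" for m
  proof (induction m)
    case (Suc m)
    have "awlast u (map (\<lambda>j. e ((s ^^ j) u)) [0..<m]) = (s ^^ m) u"
      by (simp add: verts)
    with Suc show ?case
      by (simp add: tail head)
  qed simp
  then have "cas u p u"
    using enum(2) by (metis p_def)
  then have walk: "awalk u p u"
    by (simp add: awalk_def V set_p)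
  \<comment> \<open>The first vertex recurs as the last, so \<open>cycle\<close> asks for
    distinctness of the tail only.\<close>
  have "tl (awalk_verts u p) = map (\<lambda>j. s ((s ^^ j) u)) [0..<n]"
    using \<open>p \<noteq> []\<close> by (simp add: awalk_verts_conv'[OF \<open>cas u p u\<close>]) (simp add: p_def head)
  moreover have "inj_on (\<lambda>j. s ((s ^^ j) u)) {..<n}"
    using comp_inj_on[OF inj, of s] \<open>bij s\<close>
    by (auto simp: o_def bij_def intro: inj_on_subset)
  ultimately have "distinct (tl (awalk_verts u p))"
    by (simp add: distinct_map lessThan_atLeast0)
  with walk \<open>p \<noteq> []\<close> have "cycle p"
    by (auto simp: cycle_def)
  moreover have "set (awalk_verts u p) = verts H"
    unfolding p_def verts using \<open>n > 0\<close> range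
    by (auto simp: V lessThan_atLeast0)
  ultimately show "directed_hamiltonian_cycle H"
    unfolding directed_hamiltonian_cycle_def using walk set_p by blast
qed

section \<open>The matrix as a quadratic form\<close>

text \<open>\<open>X\<close> acts on vectors by composition with \<open>s\<close>, and a matrix and
  its transpose have the same quadratic form, which absorbs the factor 1/2.\<close>

lemma quadratic_form_two_step:
  fixes x :: "real^'n::finite" and s :: "'n \<Rightarrow> 'n"
  defines "X \<equiv> \<chi> i j. if j = s i then 1 else 0"
  shows "x \<bullet> ((\<beta> *\<^sub>R mat 1 + \<alpha> *\<^sub>R all_ones - (1 / 2) *\<^sub>R ((X + X ** X) + transpose (X + X ** X))) *v x)
    = \<beta> * (\<Sum>i\<in>UNIV. (x $ i)\<^sup>2) + \<alpha> * (\<Sum>i\<in>UNIV. x $ i)\<^sup>2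
      - (\<Sum>i\<in>UNIV. x $ i * x $ s i) - (\<Sum>i\<in>UNIV. x $ i * x $ s (s i))"
proof -
  have X: "X *v y = (\<chi> i. y $ s i)" for y
    by (simp add: vec_eq_iff X_def matrix_vector_mult_def if_distrib[of "\<lambda>c. c * _"] cong: if_cong)
  define B where "B = X + X ** X"
  have B: "B *v x = (\<chi> i. x $ s i + x $ s (s i))"
    by (simp add: B_def matrix_vector_mult_add_rdistrib matrix_vector_mul_assoc[symmetric] X vec_eq_iff)
  have tr: "x \<bullet> (x v* B) = x \<bullet> (B *v x)"
    by (metis dot_lmul_matrix inner_commute)
  have J: "all_ones *v x = (\<chi> i. \<Sum>j\<in>UNIV. x $ j)"
    by (simp add: all_ones_def matrix_vector_mult_def)
  show ?thesis
    unfolding B_def[symmetric]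
    by (simp add: matrix_vector_mult_add_rdistrib matrix_vector_mult_diff_rdistrib
          scaleR_matrix_vector_assoc[symmetric] inner_add_right inner_diff_right tr J B)
       (simp add: inner_vec_def sum.distrib algebra_simps power2_eq_square sum_distrib_left sum_distrib_right)
qed

lemma symmetric_part_transpose:
  fixes M :: "real^'n^'n"
  shows "transpose (\<beta> *\<^sub>R mat 1 + \<alpha> *\<^sub>R all_ones - (1 / 2) *\<^sub>R (M + transpose M))
    = \<beta> *\<^sub>R mat 1 + \<alpha> *\<^sub>R all_ones - (1 / 2) *\<^sub>R (M + transpose M)"
  by (simp add: vec_eq_iff transpose_def mat_def all_ones_def eq_commute)

section \<open>Semidefiniteness and the single-orbit condition\<close>

theorem theorem11:
  fixes n :: nat
    and G H :: "('n::finite, 'b) pre_digraph"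
    and X X2 :: "real^'n^'n"
    and \<alpha> \<beta> :: real
  assumes n: "n = CARD('n)"
    and G: "digraph G" "verts G = (UNIV :: 'n set)"
    and H: "spanning H G"
    and deg: "\<And>v. v \<in> verts H \<Longrightarrow> in_degree H v = 1 \<and> out_degree H v = 1"
    and X: "X = adjacency_matrix H"
    and X2: "X2 = X ** X"
    and \<alpha>: "\<alpha> \<ge> h2 n / real n"
    and \<beta>: "k2 n \<le> \<beta>" "\<beta> < 2"
    and n4: "n = 4 \<Longrightarrow> 0 \<le> \<beta>"
  shows "directed_hamiltonian_cycle H \<longleftrightarrow>
    positive_semidefinite
      (\<beta> *\<^sub>R mat 1 + \<alpha> *\<^sub>R all_ones - (1 / 2) *\<^sub>R ((X + X2) + transpose (X + X2)))"
proof -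
  have V: "verts H = UNIV" and wf: "wf_digraph H"
    using H G by (auto simp: spanning_def subgraph_def)
  have deg': "in_degree H v = 1 \<and> out_degree H v = 1" for v
    using deg by (simp add: V)
  obtain s e where "bij s" and arcs: "arcs H = range e"
    and tail: "\<And>v. tail H (e v) = v" and head: "\<And>v. head H (e v) = s v"
    using one_regular_digraph_successor[OF wf V deg'] by blast
  have "X = (\<chi> i j. if j = s i then 1 else 0)"
    by (auto simp: X adjacency_matrix_def arcs_ends_conv arcs tail head vec_eq_iff image_iff)
  note form = quadratic_form_two_step[where s = s, folded this X2]
  define Q where "Q x = \<beta> * (\<Sum>i\<in>UNIV. (x i)\<^sup>2) + \<alpha> * (\<Sum>i\<in>UNIV. x i)\<^sup>2
      - (\<Sum>i\<in>UNIV. x i * x (s i)) - (\<Sum>i\<in>UNIV. x i * x (s (s i)))" for x :: "'n \<Rightarrow> real"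
  have "positive_semidefinite
      (\<beta> *\<^sub>R mat 1 + \<alpha> *\<^sub>R all_ones - (1 / 2) *\<^sub>R ((X + X2) + transpose (X + X2)))
    \<longleftrightarrow> (\<forall>x :: real^'n. 0 \<le> Q (($) x))"
    unfolding positive_semidefinite_def symmetric_part_transpose form Q_def by simp
  also have "\<dots> \<longleftrightarrow> (\<forall>x. 0 \<le> Q x)"
  proof safe
    fix x assume "\<forall>x :: real^'n. 0 \<le> Q (($) x)"
    from this[rule_format, of "vec_lambda x"] show "0 \<le> Q x"
      by (simp add: vec_lambda_inverse)
  qed simp
  also have "\<dots> \<longleftrightarrow> (\<exists>u. orbit s u = UNIV)"
  proof
    assume nonneg: "\<forall>x. 0 \<le> Q x"
    \<comment> \<open>Any vertex will do: its orbit is shown directly to be everything.\<close>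
    fix u :: 'n
    define C where "C = orbit s u"
    have "permutation s"
      using \<open>bij s\<close> by (simp add: permutation)
    then have u: "u \<in> C"
      by (simp add: C_def permutation_self_in_orbit)
    have inv: "s i \<in> C \<longleftrightarrow> i \<in> C" for i
      unfolding C_def
      by (metis \<open>permutation s\<close> orbit.step orbit_swap orbit_trans permutation_orbit_step permutation_self_in_orbit u)
    \<comment> \<open>The weights balance to sum zero, which removes the \<alpha> term; invariance
      under \<open>s\<close> makes both shifted sums equal to the sum of squares. If
      \<open>C = UNIV\<close>, this is the zero vector, so no case split is needed.\<close>
    define x where "x i = (if i \<in> C then real (n - card C) else - real (card C))" for i
    have "card C \<le> n"
      unfolding n by (intro card_mono) auto
    have "(\<Sum>i\<in>UNIV. x i) = real (card C) * real (n - card C) - real (card (- C)) * real (card C)"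
      by (simp add: x_def sum.If_cases)
    also have "card (- C) = n - card C"
      unfolding n by (simp add: Compl_eq_Diff_UNIV card_Diff_subset)
    finally have sum0: "(\<Sum>i\<in>UNIV. x i) = 0"
      by (simp add: mult.commute)
    have "Q x = (\<beta> - 2) * (\<Sum>i\<in>UNIV. (x i)\<^sup>2)"
    proof -
      have "x (s i) = x i" for i
        by (simp add: x_def inv)
      then show ?thesis
        by (simp add: Q_def sum0 power2_eq_square algebra_simps)
    qed
    \<comment> \<open>As \<open>\<beta> < 2\<close>, nonnegativity forces \<open>x\<close> to
      vanish; its value n - |C| at \<open>u\<close> then gives |C| = n.\<close>
    with nonneg \<beta>(2) have "(\<Sum>i\<in>UNIV. (x i)\<^sup>2) \<le> 0"
      by (metis diff_less_0_iff_less mult_neg_pos not_le)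
    then have "(x u)\<^sup>2 \<le> 0"
      by (rule order_trans[rotated]) (rule member_le_sum, auto)
    then have "card C = n"
      using u \<open>card C \<le> n\<close> by (simp add: x_def)
    then have "C = UNIV"
      unfolding n by (intro card_subset_eq) auto
    then show "\<exists>u. orbit s u = UNIV"
      unfolding C_def by blast
  next
    assume "\<exists>u. orbit s u = UNIV"
    then obtain u where "orbit s u = UNIV" ..
    note enum = orbit_eq_UNIV_enumerates[OF \<open>bij s\<close> this, folded n]
    show "\<forall>x. 0 \<le> Q x"
    proof
      fix x :: "'n \<Rightarrow> real"
      \<comment> \<open>Read along the cycle, \<open>x\<close> is an n-periodic sequence, and
        applying \<open>s\<close> becomes the shift of \<open>j\<close> by one.\<close>
      have per: "x ((s ^^ (j + n)) u) = x ((s ^^ j) u)" for j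
        by (simp add: funpow_add enum(2))
      have "n > 0" by (simp add: n)
      have reindex: "(\<Sum>i\<in>UNIV. f i) = (\<Sum>j<n. f ((s ^^ j) u))" for f :: "'n \<Rightarrow> real"
        by (rule sum.reindex_bij_betw[OF enum(1), symmetric])
      show "0 \<le> Q x"
        using periodic_quadratic_form_nonneg[of n "\<lambda>j. x ((s ^^ j) u)", OF \<open>n > 0\<close> per \<alpha> \<beta>(1) n4]
        by (simp add: Q_def reindex)
    qed
  qed
  finally show ?thesis
    using hamiltonian_cycle_iff_orbit[OF wf V \<open>bij s\<close> arcs tail head] by blast
qed

end
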